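(* Let $1\le \ell\le d$ be integers and let $(\mathbf{P}_k)_{k\ge 0}$ be i.i.d. random matrices in $\mathbb{R}^{d\times \ell}$ such that $\mathbb{E}\,\mathbf{P}_k\mathbf{P}_k^\top=\mathbf{I}_d$ and $\mathbf{P}_k^\top\mathbf{P}_k=(d/\ell)\,\mathbf{I}_\ell$. Let $f:\mathbb{R}^d\to\mathbb{R}$ be convex and continuously differentiable with $\lambda$-Lipschitz gradient ($\lambda>0$), and suppose $f$ attains its minimum $f_*$; let $\mathcal{D}=\{\mathbf{x}_*\in\mathbb{R}^d: f(\mathbf{x}_* )=f_*\}$. Let $\mathbf{x}_0\in\mathbb{R}^d$ be a (deterministic) initialization and suppose there is $R>0$ such that $\|\mathbf{x}-\mathbf{x}_*\|\le R$ for every $\mathbf{x}_*\in\mathcal{D}$ and every $\mathbf{x}\in\mathbb{R}^d$ with $f(\mathbf{x})\le f(\mathbf{x}_0)$. With $\alpha=\ell/(d\lambda)$, define $$\mathbf{x}_{k+1}=\mathbf{x}_k-\alpha\,\mathbf{P}_k\mathbf{P}_k^\top\nabla f(\mathbf{x}_k),\qquad k\ge 0.$$ Then for every $k\ge 1$, $$\mathbb{E} f(\mathbf{x}_k)-f_*\le \frac{2d\lambda R^2}{k\ell}.$$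
   Context: $\|\cdot\|$ is the Euclidean norm on $\mathbb{R}^d$, and $\mathbf{I}_n$ is the $n\times n$ identity matrix. *)

theory Defs
  imports "HOL-Probability.Probability"
begin

text \<open>
  The matrices with \<open>d\<close> rows and \<open>l\<close> columns form the type \<^typ>\<open>real ^ 'l ^ 'd\<close>,
  where \<open>d = CARD('d)\<close> and \<open>l = CARD('l)\<close>.  The iteration below is deterministic in a given
  sequence of matrices; applied to \<open>\<lambda>k. P k \<omega>\<close> it gives the random iterates.
\<close>

primrec sketched_descent ::
  "real \<Rightarrow> (real ^ 'd \<Rightarrow> real ^ 'd) \<Rightarrow> (nat \<Rightarrow> real ^ 'l ^ 'd) \<Rightarrow> real ^ 'd \<Rightarrow> nat \<Rightarrow> real ^ 'd"
where
  "sketched_descent \<alpha> g Q x0 0 = x0"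
| "sketched_descent \<alpha> g Q x0 (Suc k) =
     (let x = sketched_descent \<alpha> g Q x0 k
      in x - \<alpha> *\<^sub>R ((Q k ** transpose (Q k)) *v g x))"

definition iid :: "'a measure \<Rightarrow> (nat \<Rightarrow> 'a \<Rightarrow> 'b::topological_space) \<Rightarrow> bool" where
  "iid M X \<longleftrightarrow>
     prob_space.indep_vars M (\<lambda>_. borel) X UNIV \<and>
     (\<forall>k. distr M borel (X k) = distr M borel (X 0))"

end

theory Submission
  imports Defs
begin

text \<open>
  Since \<open>P\<^sub>k\<^sup>T P\<^sub>k = (d/l) I\<close>, the descent inequality for a function with Lipschitz gradient gives, for every
  realisation, \<open>f (x\<^sub>k\<^sub>+\<^sub>1) \<le> f (x\<^sub>k) - (\<alpha>/2) \<bar>P\<^sub>k\<^sup>T g\<^sub>k\<bar>\<^sup>2\<close> with \<open>g\<^sub>k\<close> the gradient at \<open>x\<^sub>k\<close>.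
  Hence the iterates stay in the sublevel set of \<open>x\<^sub>0\<close>, and, as \<open>P\<^sub>k\<close> is independent of \<open>x\<^sub>k\<close>,
  the expected decrease is at least \<open>(\<alpha>/2) E \<bar>g\<^sub>k\<bar>\<^sup>2\<close>.  By convexity \<open>f (x\<^sub>k) - f\<^sub>* \<le> R \<bar>g\<^sub>k\<bar>\<close>, so
  \<open>a\<^sub>k = E f (x\<^sub>k) - f\<^sub>*\<close> satisfies \<open>a\<^sub>k\<^sub>+\<^sub>1 \<le> a\<^sub>k - c a\<^sub>k\<^sup>2\<close> with \<open>c = \<alpha>/(2 R\<^sup>2)\<close>,
  which forces \<open>a\<^sub>k \<le> 1/(c k)\<close>.
\<close>

section \<open>The scalar recursion\<close>

text \<open>With \<open>b = c * a n\<close>, the recursion gives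
  \<open>c * a (Suc n) \<le> b * (1 - b)\<close>. If \<open>n * b \<le> 1\<close> and
  \<open>b \<le> 1\<close>, then \<open>(n + 1) * b * (1 - b) \<le> (1 - b) + b = 1\<close>; if
  \<open>b > 1\<close>, the left side is negative. Inducting on the product
  \<open>n * (c * a n)\<close> makes the base case trivial, whatever the size of
  \<open>a 0\<close>.\<close>

lemma quadratic_decrease_bound:
  fixes a :: "nat \<Rightarrow> real"
  assumes "c > 0"
    and nonneg: "\<And>k. 0 \<le> a k"
    and step: "\<And>k. a (Suc k) \<le> a k - c * (a k)\<^sup>2"
    and "k \<ge> 1"
  shows "a k \<le> 1 / (c * real k)"
proof -
  have "real n * (c * a n) \<le> 1" for n
  proof (induction n)
    case 0
    then show ?case by simp
  next
    case (Suc n)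
    define b where "b = c * a n"
    have b: "b \<ge> 0" "real n * b \<le> 1"
      using Suc nonneg \<open>c > 0\<close> by (auto simp: b_def)
    have "c * a (Suc n) \<le> b * (1 - b)"
      using mult_left_mono[OF step[of n], of c] \<open>c > 0\<close>
      by (simp add: b_def algebra_simps power2_eq_square)
    then have *: "real (Suc n) * (c * a (Suc n)) \<le> real (Suc n) * (b * (1 - b))"
      by (intro mult_left_mono) auto
    show ?case
    proof (cases "b \<le> 1")
      case True
      have "real (Suc n) * (b * (1 - b)) = (real n * b) * (1 - b) + b * (1 - b)"
        by (simp add: algebra_simps)
      also have "\<dots> \<le> 1 * (1 - b) + b * 1"
        using b True by (intro add_mono mult_mono) auto
      also have "\<dots> = 1" by simp
      finally show ?thesis by (rule order_trans[OF *])
    next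
      case False
      then have "real (Suc n) * (b * (1 - b)) \<le> 0"
        using b by (intro mult_nonneg_nonpos) auto
      then show ?thesis using * by linarith
    qed
  qed
  from this[of k] show ?thesis
    using assms(1,4) by (simp add: field_simps)
qed

section \<open>Smooth and convex functions along a line\<close>

lemma gderiv_along_line:
  fixes f :: "'a::real_inner \<Rightarrow> real"
  assumes "\<And>y. GDERIV f y :> grad y"
  shows "((\<lambda>t. f (y + t *\<^sub>R h)) has_real_derivative h \<bullet> grad (y + t *\<^sub>R h)) (at t)"
proof -
  have "((\<lambda>t. f (y + t *\<^sub>R h)) has_derivative (\<lambda>s. (s *\<^sub>R h) \<bullet> grad (y + t *\<^sub>R h))) (at t)"
    using assms[of "y + t *\<^sub>R h"] unfolding gderiv_def
    by (rule has_derivative_compose[rotated]) (auto intro!: derivative_eq_intros)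
  then show ?thesis
    by (simp add: has_field_derivative_def mult.commute[of _ "h \<bullet> grad (y + t *\<^sub>R h)"] 
        mult_commute_abs)
qed

text \<open>The function \<open>\<phi>\<close> is \<open>f\<close> along the segment minus its
  linear and quadratic model. By Cauchy-Schwarz and the Lipschitz bound its derivative is
  nonpositive for \<open>t \<ge> 0\<close>, so \<open>\<phi> 1 \<le> \<phi> 0\<close>.\<close>

lemma lipschitz_gradient_upper_bound:
  fixes f :: "'a::real_inner \<Rightarrow> real"
  assumes grad: "\<And>y. GDERIV f y :> grad y"
    and lip: "L-lipschitz_on UNIV grad"
  shows "f (y + h) \<le> f y + h \<bullet> grad y + L / 2 * (norm h)\<^sup>2"
proof -
  define \<phi> where "\<phi> t = f (y + t *\<^sub>R h) - t * (h \<bullet> grad y) - L / 2 * (norm h)\<^sup>2 * t\<^sup>2" for t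
  have "\<phi> 1 \<le> \<phi> 0"
  proof (rule DERIV_nonpos_imp_nonincreasing[where f = \<phi>])
    fix t :: real
    assume t: "0 \<le> t"
    have "(\<phi> has_real_derivative h \<bullet> grad (y + t *\<^sub>R h) - h \<bullet> grad y - L * (norm h)\<^sup>2 * t) (at t)"
      unfolding \<phi>_def
      by (auto intro!: derivative_eq_intros gderiv_along_line[OF grad])
    moreover have "h \<bullet> grad (y + t *\<^sub>R h) - h \<bullet> grad y \<le> L * (norm h)\<^sup>2 * t"
    proof -
      have "h \<bullet> grad (y + t *\<^sub>R h) - h \<bullet> grad y \<le> norm h * norm (grad (y + t *\<^sub>R h) - grad y)"
        using norm_cauchy_schwarz[of h "grad (y + t *\<^sub>R h) - grad y"] by (simp add: inner_diff_right)
      also have "norm (grad (y + t *\<^sub>R h) - grad y) \<le> L * (t * norm h)"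
        using lipschitz_onD[OF lip, of "y + t *\<^sub>R h" y] t by (simp add: dist_norm)
      finally have "h \<bullet> grad (y + t *\<^sub>R h) - h \<bullet> grad y \<le> norm h * (L * (t * norm h))"
        by (simp add: mult_left_mono)
      then show ?thesis by (simp add: power2_eq_square mult_ac)
    qed
    ultimately show "\<exists>D. (\<phi> has_real_derivative D) (at t) \<and> D \<le> 0"
      by (intro exI conjI) (assumption, simp)
  qed simp
  then show ?thesis by (simp add: \<phi>_def)
qed

text \<open>Restricting \<open>f\<close> to the line through \<open>y\<close> and \<open>z\<close>
  reduces the claim to the one-dimensional tangent inequality, with the tangent at 0 evaluated at
  1.\<close>

lemma convex_above_tangent_gradient:
  fixes f :: "'a::real_inner \<Rightarrow> real"
  assumes cvx: "convex_on UNIV f"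
    and grad: "\<And>y. GDERIV f y :> grad y"
  shows "f z \<ge> f y + (z - y) \<bullet> grad y"
proof -
  have "convex_on UNIV (\<lambda>t. f (y + t *\<^sub>R (z - y)))"
  proof (rule convex_onI)
    fix t a b :: real
    assume t: "0 < t" "t < 1"
    have "y + ((1 - t) *\<^sub>R a + t *\<^sub>R b) *\<^sub>R (z - y)
        = (1 - t) *\<^sub>R (y + a *\<^sub>R (z - y)) + t *\<^sub>R (y + b *\<^sub>R (z - y))"
      by (simp add: algebra_simps)
    then show "f (y + ((1 - t) *\<^sub>R a + t *\<^sub>R b) *\<^sub>R (z - y))
        \<le> (1 - t) * f (y + a *\<^sub>R (z - y)) + t * f (y + b *\<^sub>R (z - y))"
      using convex_onD[OF cvx, of t "y + a *\<^sub>R (z - y)" "y + b *\<^sub>R (z - y)"] t by simp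
  qed simp
  from convex_on_imp_above_tangent[OF this connected_UNIV, of 0 1]
    gderiv_along_line[of f grad y "z - y" 0, OF grad]
  show ?thesis by fastforce
qed

section \<open>One step with a fixed matrix\<close>

lemma inner_gram_matrix:
  fixes Q :: "real ^ 'l ^ 'd"
  shows "v \<bullet> ((Q ** transpose Q) *v v) = (norm (transpose Q *v v))\<^sup>2"
  by (simp add: power2_norm_eq_inner dot_lmul_matrix matrix_vector_mul_assoc[symmetric])

text \<open>\<open>Q\<close> scales every squared norm by \<open>c\<close>; this is applied to
  \<open>transpose Q *v v\<close>. The first- and second-order terms of a step thus become multiples
  of the same quantity.\<close>

lemma norm_gram_matrix_scaled_isometry:
  fixes Q :: "real ^ 'l ^ 'd"
  assumes "transpose Q ** Q = c *\<^sub>R mat 1"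
  shows "(norm ((Q ** transpose Q) *v v))\<^sup>2 = c * (norm (transpose Q *v v))\<^sup>2"
proof -
  let ?w = "transpose Q *v v"
  have "(norm ((Q ** transpose Q) *v v))\<^sup>2 = (Q *v ?w) \<bullet> (Q *v ?w)"
    by (simp only: power2_norm_eq_inner matrix_vector_mul_assoc)
  also have "\<dots> = ((Q *v ?w) v* Q) \<bullet> ?w"
    by (simp only: dot_lmul_matrix)
  also have "(Q *v ?w) v* Q = (transpose Q ** Q) *v ?w"
    by (simp only: transpose_matrix_vector[symmetric] matrix_vector_mul_assoc matrix_mul_assoc)
  also have "\<dots> = c *\<^sub>R ?w"
    unfolding assms by (simp only: scaleR_matrix_vector_assoc[symmetric] matrix_vector_mul_lid)
  finally show ?thesis by (simp add: power2_norm_eq_inner)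
qed

lemma sketched_descent_step_decrease:
  fixes Q :: "real ^ 'l ^ 'd"
  assumes grad: "\<And>y. GDERIV f y :> grad y"
    and lip: "L-lipschitz_on UNIV grad"
    and Q: "transpose Q ** Q = c *\<^sub>R mat 1"
    and \<alpha>: "\<alpha> * (L * c) = 1"
  shows "f (y - \<alpha> *\<^sub>R ((Q ** transpose Q) *v grad y))
      \<le> f y - \<alpha> / 2 * (grad y \<bullet> ((Q ** transpose Q) *v grad y))"
proof -
  let ?u = "(Q ** transpose Q) *v grad y" and ?n = "(norm (transpose Q *v grad y))\<^sup>2"
  have 1: "?u \<bullet> grad y = ?n" "grad y \<bullet> ?u = ?n"
    using inner_gram_matrix[of "grad y" Q] by (simp_all add: inner_commute)
  have 2: "(norm (\<alpha> *\<^sub>R ?u))\<^sup>2 = \<alpha>\<^sup>2 * (c * ?n)"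
    by (simp only: norm_scaleR power_mult_distrib norm_gram_matrix_scaled_isometry[OF Q] power2_abs)
  have "f (y + - (\<alpha> *\<^sub>R ?u)) \<le> f y + - (\<alpha> *\<^sub>R ?u) \<bullet> grad y + L / 2 * (norm (- (\<alpha> *\<^sub>R ?u)))\<^sup>2"
    by (rule lipschitz_gradient_upper_bound[OF grad lip])
  also have "\<dots> = f y - \<alpha> * ?n + L / 2 * (\<alpha>\<^sup>2 * (c * ?n))"
    by (simp only: norm_minus_cancel 2 inner_minus_left inner_scaleR_left 1 add_uminus_conv_diff)
  \<comment> \<open>Grouped this way, the factor \<open>\<alpha> * (L * c) = 1\<close> shows that
    the quadratic term costs exactly half of the linear gain \<open>\<alpha> * ?n\<close>.\<close>
  also have "L / 2 * (\<alpha>\<^sup>2 * (c * ?n)) = (\<alpha> * (L * c)) * (\<alpha> / 2 * ?n)"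
    by (simp add: power2_eq_square)
  finally show ?thesis by (simp add: \<alpha> 1)
qed

section \<open>Measurability and independence of the iterates\<close>

text \<open>The strict bound \<open>j < k\<close> matters: iterate \<open>k\<close> does not read
  matrix \<open>k\<close>, which is the source of its independence from \<open>P k\<close>.\<close>

lemma sketched_descent_cong:
  assumes "\<And>j. j < k \<Longrightarrow> Q j = Q' j"
  shows "sketched_descent \<alpha> g Q x0 k = sketched_descent \<alpha> g Q' x0 k"
  using assms by (induction k) (simp_all add: Let_def)

lemma borel_measurable_gram_matrix:
  "(\<lambda>A :: real ^ 'l ^ 'd. A ** transpose A) \<in> borel_measurable borel"
  unfolding matrix_matrix_mult_def transpose_def
  by (intro borel_measurable_continuous_onI continuous_intros)

lemma borel_measurable_matrix_vector_mult:
  fixes A :: "'a \<Rightarrow> real ^ 'n ^ 'm"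
  assumes "A \<in> borel_measurable M" "v \<in> borel_measurable M"
  shows "(\<lambda>x. A x *v v x) \<in> borel_measurable M"
  using assms
  by (rule borel_measurable_continuous_Pair)
    (unfold matrix_vector_mult_def, intro continuous_intros)

text \<open>Separating \<open>n\<close> from \<open>k\<close> keeps the product space fixed during
  the induction on \<open>k\<close>.\<close>

lemma measurable_sketched_descent:
  fixes g :: "real ^ 'd \<Rightarrow> real ^ 'd"
  assumes g: "g \<in> borel_measurable borel" and "k \<le> n"
  shows "(\<lambda>Q :: nat \<Rightarrow> real ^ 'l ^ 'd. sketched_descent \<alpha> g Q x0 k)
      \<in> borel_measurable (PiM {..<n} (\<lambda>_. borel))"
  using \<open>k \<le> n\<close>
proof (induction k)
  case 0
  then show ?case by simp
next
  case (Suc k)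
  have 1: "(\<lambda>Q :: nat \<Rightarrow> real ^ 'l ^ 'd. sketched_descent \<alpha> g Q x0 k)
      \<in> borel_measurable (PiM {..<n} (\<lambda>_. borel))"
    using Suc by simp
  have "(\<lambda>Q :: nat \<Rightarrow> real ^ 'l ^ 'd. Q k) \<in> borel_measurable (PiM {..<n} (\<lambda>_. borel))"
    using Suc.prems by (intro measurable_component_singleton) simp
  then have "(\<lambda>Q :: nat \<Rightarrow> real ^ 'l ^ 'd. Q k ** transpose (Q k))
      \<in> borel_measurable (PiM {..<n} (\<lambda>_. borel))"
    by (rule measurable_compose[OF _ borel_measurable_gram_matrix])
  from borel_measurable_matrix_vector_mult[OF this measurable_compose[OF 1 g]] 1
  show ?case by (simp add: Let_def)
qed

text \<open>
  The constant \<^const>\<open>prob_space.indep_var\<close> only relates random variables with values in the same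
  type, hence the functions \<open>u\<close> and \<open>v\<close>.
\<close>

lemma (in prob_space) indep_var_sketched_descent:
  fixes P :: "nat \<Rightarrow> 'a \<Rightarrow> real ^ 'l ^ 'd"
  assumes ind: "indep_vars (\<lambda>_. borel) P UNIV"
    and g: "g \<in> borel_measurable borel"
    and u: "u \<in> borel \<rightarrow>\<^sub>M N"
    and v: "v \<in> borel \<rightarrow>\<^sub>M N'"
  shows "indep_var N (\<lambda>\<omega>. u (sketched_descent \<alpha> g (\<lambda>j. P j \<omega>) x0 k)) N' (\<lambda>\<omega>. v (P k \<omega>))"
proof -
  \<comment> \<open>The disjoint index blocks \<open>{..<k}\<close> and \<open>{k}\<close> give
    independent families; the iterate is a function of the first, \<open>P k\<close> of the
    second.\<close>
  have "indep_var (PiM {..<k} (\<lambda>_. borel)) (\<lambda>\<omega>. restrict (\<lambda>i. P i \<omega>) {..<k})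
      (PiM {k} (\<lambda>_. borel)) (\<lambda>\<omega>. restrict (\<lambda>i. P i \<omega>) {k})"
    by (rule indep_var_restrict[OF ind]) auto
  moreover have "(\<lambda>Q. u (sketched_descent \<alpha> g Q x0 k)) \<in> PiM {..<k} (\<lambda>_. borel) \<rightarrow>\<^sub>M N"
    by (rule measurable_compose[OF measurable_sketched_descent[OF g order_refl] u])
  moreover have "(\<lambda>Q. v (Q k)) \<in> PiM {k} (\<lambda>_. borel) \<rightarrow>\<^sub>M N'"
    by (rule measurable_compose[OF _ v]) (rule measurable_component_singleton, simp)
  ultimately have "indep_var N (\<lambda>\<omega>. u (sketched_descent \<alpha> g (restrict (\<lambda>i. P i \<omega>) {..<k}) x0 k))
      N' (\<lambda>\<omega>. v (P k \<omega>))"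
    by (auto dest: indep_var_compose simp: comp_def)
  also have "(\<lambda>\<omega>. u (sketched_descent \<alpha> g (restrict (\<lambda>i. P i \<omega>) {..<k}) x0 k))
      = (\<lambda>\<omega>. u (sketched_descent \<alpha> g (\<lambda>j. P j \<omega>) x0 k))"
    by (intro ext arg_cong[of _ _ u] sketched_descent_cong) simp
  finally show ?thesis .
qed

text \<open>The form is a finite sum of products of \<open>X $ i * X $ j\<close> with
  \<open>A $ i $ j\<close>, and each expectation factors by independence. The bound on
  \<open>X\<close> makes the first factors integrable. Independence is assumed entrywise because
  both variables are then real-valued.\<close>

lemma (in prob_space) quadratic_form_indep:
  fixes X :: "'a \<Rightarrow> real ^ 'n" and A :: "'a \<Rightarrow> real ^ 'n ^ 'n"
  assumes X: "X \<in> borel_measurable M"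
    and ind: "\<And>i j. indep_var borel (\<lambda>\<omega>. X \<omega> $ i * X \<omega> $ j) borel (\<lambda>\<omega>. A \<omega> $ i $ j)"
    and A: "integrable M A"
    and bdd: "AE \<omega> in M. norm (X \<omega>) \<le> B"
  shows integrable_quadratic_form_indep: "integrable M (\<lambda>\<omega>. X \<omega> \<bullet> (A \<omega> *v X \<omega>))"
    and expectation_quadratic_form_indep:
      "(\<integral>\<omega>. X \<omega> \<bullet> (A \<omega> *v X \<omega>) \<partial>M) = (\<integral>\<omega>. X \<omega> \<bullet> ((\<integral>\<omega>. A \<omega> \<partial>M) *v X \<omega>) \<partial>M)"
proof -
  have expand: "v \<bullet> (C *v v) = (\<Sum>i\<in>UNIV. \<Sum>j\<in>UNIV. (v $ i * v $ j) * C $ i $ j)"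
    for v :: "real ^ 'n" and C
    by (simp add: inner_vec_def matrix_vector_mult_def sum_distrib_left mult_ac)
  have entry: "bounded_linear (\<lambda>C :: real ^ 'n ^ 'n. C $ i $ j)" for i j
    by (rule bounded_linear_compose[OF bounded_linear_vec_nth bounded_linear_vec_nth])
  have XX: "integrable M (\<lambda>\<omega>. X \<omega> $ i * X \<omega> $ j)" for i j
  proof (rule integrable_const_bound)
    show "AE \<omega> in M. norm (X \<omega> $ i * X \<omega> $ j) \<le> B * B"
      using bdd
    proof eventually_elim
      case (elim \<omega>)
      then have "\<bar>X \<omega> $ i\<bar> \<le> B" "\<bar>X \<omega> $ j\<bar> \<le> B"
        using component_le_norm_cart order_trans by blast+
      then show ?case by (auto simp: abs_mult intro!: mult_mono)
    qed
    have "(\<lambda>v :: real ^ 'n. v $ i * v $ j) \<in> borel_measurable borel"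
      by (intro borel_measurable_continuous_onI continuous_intros)
    then show "(\<lambda>\<omega>. X \<omega> $ i * X \<omega> $ j) \<in> borel_measurable M"
      by (rule measurable_compose[OF X])
  qed
  have Aij: "integrable M (\<lambda>\<omega>. A \<omega> $ i $ j)"
    and intA: "(\<integral>\<omega>. A \<omega> \<partial>M) $ i $ j = (\<integral>\<omega>. A \<omega> $ i $ j \<partial>M)" for i j
    using integrable_bounded_linear[OF entry A] integral_bounded_linear[OF entry A] by simp_all
  note prods = indep_var_integrable[OF ind XX Aij] indep_var_lebesgue_integral[OF ind XX Aij]
  show "integrable M (\<lambda>\<omega>. X \<omega> \<bullet> (A \<omega> *v X \<omega>))"
    unfolding expand by (intro Bochner_Integration.integrable_sum prods)
  show "(\<integral>\<omega>. X \<omega> \<bullet> (A \<omega> *v X \<omega>) \<partial>M) = (\<integral>\<omega>. X \<omega> \<bullet> ((\<integral>\<omega>. A \<omega> \<partial>M) *v X \<omega>) \<partial>M)"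
    unfolding expand
    by (simp add: Bochner_Integration.integral_sum prods XX intA)
qed

lemma (in prob_space) expectation_square_le:
  fixes Y :: "'a \<Rightarrow> real"
  assumes "integrable M Y" "integrable M (\<lambda>\<omega>. (Y \<omega>)\<^sup>2)"
  shows "(expectation Y)\<^sup>2 \<le> expectation (\<lambda>\<omega>. (Y \<omega>)\<^sup>2)"
  using variance_positive[of Y] variance_eq[OF assms] by simp

text \<open>Integrability belongs to the conclusion, since a Bochner integral that defaults to 0
  would say nothing about the expectation.\<close>

theorem theorem2:
  fixes M :: "'a measure"
    and P :: "nat \<Rightarrow> 'a \<Rightarrow> real ^ 'l ^ 'd"
    and f :: "real ^ 'd \<Rightarrow> real"
    and grad :: "real ^ 'd \<Rightarrow> real ^ 'd"
    and x0 :: "real ^ 'd"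
    and lam fmin R \<alpha> :: real
    and x :: "nat \<Rightarrow> 'a \<Rightarrow> real ^ 'd"
  assumes "prob_space M"
    and "CARD('l) \<le> CARD('d)"
    and "iid M P"
    and "\<And>k. (\<integral>\<omega>. P k \<omega> ** transpose (P k \<omega>) \<partial>M) = mat 1"
    and "\<And>k. AE \<omega> in M.
           transpose (P k \<omega>) ** P k \<omega> = (real CARD('d) / real CARD('l)) *\<^sub>R mat 1"
    and "convex_on UNIV f"
    and "\<And>y. GDERIV f y :> grad y"
    and "continuous_on UNIV grad"
    and "lam > 0"
    and "lam-lipschitz_on UNIV grad"
    and "\<exists>y. f y = fmin"
    and "\<And>y. fmin \<le> f y"
    and "R > 0"
    and "\<And>xstar y. xstar \<in> {z. f z = fmin} \<Longrightarrow> f y \<le> f x0 \<Longrightarrow> norm (y - xstar) \<le> R"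
    and "\<alpha> = real CARD('l) / (real CARD('d) * lam)"
    and "x = (\<lambda>k \<omega>. sketched_descent \<alpha> grad (\<lambda>j. P j \<omega>) x0 k)"
  shows "\<forall>k\<ge>1. integrable M (\<lambda>\<omega>. f (x k \<omega>)) \<and>
           (\<integral>\<omega>. f (x k \<omega>) \<partial>M) - fmin
             \<le> 2 * real CARD('d) * lam * R\<^sup>2 / (real k * real CARD('l))"
proof -
  interpret prob_space M by fact
  define g where "g k \<omega> = grad (x k \<omega>)" for k \<omega>
  define A where "A k \<omega> = P k \<omega> ** transpose (P k \<omega>)" for k \<omega>
  define c where "c = real CARD('d) / real CARD('l)"
  note grad = assms(7)
  have \<alpha>_pos: "\<alpha> > 0" and \<alpha>: "\<alpha> * (lam * c) = 1"
    using assms(9) by (simp_all add: assms(15) c_def field_simps)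
  have ind: "indep_vars (\<lambda>_. borel) P UNIV"
    using assms(3) by (simp add: iid_def)
  have grad_meas: "grad \<in> borel_measurable borel"
    using assms(8) by (rule borel_measurable_continuous_onI)
  have f_meas: "f \<in> borel_measurable borel"
    using grad unfolding gderiv_def
    by (intro borel_measurable_continuous_onI continuous_at_imp_continuous_on)
      (blast intro: has_derivative_continuous)
  \<comment> \<open>Measurability is read off from an independent pair whose second member is the
    dummy constant 0.\<close>
  have x_meas: "x k \<in> borel_measurable M" for k
    using indep_var_rv1[OF indep_var_sketched_descent[OF ind grad_meas measurable_ident
          borel_measurable_const[of 0], of \<alpha> x0 k]]
    by (simp add: assms(16))
  obtain xstar where xstar: "f xstar = fmin"
    using assms(11) by blast
  have x_Suc: "x (Suc k) \<omega> = x k \<omega> - \<alpha> *\<^sub>R (A k \<omega> *v g k \<omega>)" for k \<omega>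
    by (simp add: assms(16) g_def A_def Let_def)

  \<comment> \<open>Almost sure decrease and boundedness\<close>
  have decrease: "AE \<omega> in M. f (x (Suc k) \<omega>) \<le> f (x k \<omega>) - \<alpha> / 2 * (g k \<omega> \<bullet> (A k \<omega> *v g k \<omega>))" for k
    using assms(5)[of k]
  proof eventually_elim
    case (elim \<omega>)
    then show ?case
      unfolding x_Suc A_def g_def c_def[symmetric]
      by (rule sketched_descent_step_decrease[OF grad assms(10) _ \<alpha>])
  qed
  have form_nonneg: "g k \<omega> \<bullet> (A k \<omega> *v g k \<omega>) \<ge> 0" for k \<omega>
    unfolding A_def inner_gram_matrix by simp
  have sublevel: "AE \<omega> in M. f (x k \<omega>) \<le> f x0" for k
  proof (induction k)
    case 0
    then show ?case by (simp add: assms(16))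
  next
    case (Suc k)
    from Suc decrease[of k] show ?case
    proof eventually_elim
      case (elim \<omega>)
      moreover have "0 \<le> \<alpha> / 2 * (g k \<omega> \<bullet> (A k \<omega> *v g k \<omega>))"
        using \<alpha>_pos form_nonneg by simp
      ultimately show ?case by linarith
    qed
  qed
  have dist_le: "AE \<omega> in M. norm (x k \<omega> - xstar) \<le> R" for k
    using sublevel[of k] by eventually_elim (use assms(14) xstar in auto)
  \<comment> \<open>Lipschitz continuity turns the distance bound into a bound on the gradient, as
    required to take the expectation of the quadratic form.\<close>
  have g_bdd: "AE \<omega> in M. norm (g k \<omega>) \<le> norm (grad xstar) + lam * R" for k
    using dist_le[of k]
  proof eventually_elim
    case (elim \<omega>)
    have "norm (g k \<omega> - grad xstar) \<le> lam * norm (x k \<omega> - xstar)"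
      using lipschitz_onD[OF assms(10), of "x k \<omega>" xstar] by (simp add: g_def dist_norm)
    also have "\<dots> \<le> lam * R"
      using elim assms(9) by (intro mult_left_mono) auto
    finally show ?case
      using norm_triangle_sub[of "g k \<omega>" "grad xstar"] by linarith
  qed

  text \<open>The Bochner integral of a non-integrable function is \<open>0\<close>, so the second-moment
    condition already contains integrability.\<close>
  have A_int: "integrable M (A k)" for k
  proof (rule ccontr)
    assume "\<not> integrable M (A k)"
    then have "(mat 1 :: real ^ 'd ^ 'd) = 0"
      using assms(4)[of k] not_integrable_integral_eq[of M "A k"] by (simp add: A_def[abs_def])
    then have "(mat 1 :: real ^ 'd ^ 'd) $ i $ i = 0" for i
      by simp
    then show False by (simp add: mat_def)
  qed
  have g_borel: "g k \<in> borel_measurable M" for k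
    unfolding g_def by (rule measurable_compose[OF x_meas grad_meas])
  have indg: "indep_var borel (\<lambda>\<omega>. g k \<omega> $ i * g k \<omega> $ j) borel (\<lambda>\<omega>. A k \<omega> $ i $ j)" for k i j
  proof -
    have "(\<lambda>v :: real ^ 'd. v $ i * v $ j) \<in> borel_measurable borel"
      "(\<lambda>C :: real ^ 'd ^ 'd. C $ i $ j) \<in> borel_measurable borel"
      by (intro borel_measurable_continuous_onI continuous_intros)+
    from indep_var_sketched_descent[OF ind grad_meas measurable_compose[OF grad_meas this(1)]
        measurable_compose[OF borel_measurable_gram_matrix this(2)]]
    show ?thesis by (simp add: g_def A_def assms(16))
  qed
  note form_int = integrable_quadratic_form_indep[OF g_borel indg A_int g_bdd]
  \<comment> \<open>Independence replaces \<open>A k\<close> by its expectation, the identity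
    matrix.\<close>
  have form_exp: "(\<integral>\<omega>. g k \<omega> \<bullet> (A k \<omega> *v g k \<omega>) \<partial>M) = (\<integral>\<omega>. (norm (g k \<omega>))\<^sup>2 \<partial>M)" for k
    using expectation_quadratic_form_indep[OF g_borel indg A_int g_bdd, of k] assms(4)[of k]
    by (simp add: A_def power2_norm_eq_inner)

  have f_int: "integrable M (\<lambda>\<omega>. f (x k \<omega>))" for k
  proof (rule integrable_const_bound)
    show "AE \<omega> in M. norm (f (x k \<omega>)) \<le> \<bar>fmin\<bar> + \<bar>f x0\<bar>"
      using sublevel[of k]
    proof eventually_elim
      case (elim \<omega>)
      then show ?case using assms(12)[of "x k \<omega>"] by auto
    qed
  qed (rule measurable_compose[OF x_meas f_meas])
  have g_meas: "(\<lambda>\<omega>. (norm (g k \<omega>))\<^sup>2) \<in> borel_measurable M" for k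
    using g_borel[of k] by simp
  have g2_int: "integrable M (\<lambda>\<omega>. (norm (g k \<omega>))\<^sup>2)" for k
  proof (rule integrable_const_bound)
    show "AE \<omega> in M. norm ((norm (g k \<omega>))\<^sup>2) \<le> (norm (grad xstar) + lam * R)\<^sup>2"
      using g_bdd[of k] by eventually_elim (simp add: power_mono)
  qed (rule g_meas)

  \<comment> \<open>The recursion for the expected gap\<close>
  define a where "a k = (\<integral>\<omega>. f (x k \<omega>) \<partial>M) - fmin" for k
  have a_eq: "a k = (\<integral>\<omega>. f (x k \<omega>) - fmin \<partial>M)" for k
    using f_int[of k] by (simp add: a_def prob_space)
  have a_nonneg: "a k \<ge> 0" for k
    unfolding a_eq using assms(12) by (intro integral_nonneg_AE) simp
  \<comment> \<open>The tangent at \<open>x k \<omega>\<close> is compared with \<open>f\<close> at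
    \<open>xstar\<close>; squaring preserves the inequality because the gap is nonnegative.\<close>
  have gap: "AE \<omega> in M. (f (x k \<omega>) - fmin)\<^sup>2 \<le> R\<^sup>2 * (norm (g k \<omega>))\<^sup>2" for k
    using dist_le[of k]
  proof eventually_elim
    case (elim \<omega>)
    have "f (x k \<omega>) - fmin \<le> (x k \<omega> - xstar) \<bullet> g k \<omega>"
      using convex_above_tangent_gradient[OF assms(6) grad, of "x k \<omega>" xstar] xstar
      by (simp add: g_def inner_diff_left)
    also have "\<dots> \<le> norm (x k \<omega> - xstar) * norm (g k \<omega>)"
      by (rule norm_cauchy_schwarz)
    also have "\<dots> \<le> R * norm (g k \<omega>)"
      using elim by (intro mult_right_mono) auto
    finally show ?case
      using assms(12)[of "x k \<omega>"] by (simp add: power_mult_distrib[symmetric] power_mono)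
  qed
  have gap_int: "integrable M (\<lambda>\<omega>. (f (x k \<omega>) - fmin)\<^sup>2)" for k
  proof (rule Bochner_Integration.integrable_bound)
    show "integrable M (\<lambda>\<omega>. R\<^sup>2 * (norm (g k \<omega>))\<^sup>2)"
      using g2_int[of k] by simp
    show "(\<lambda>\<omega>. (f (x k \<omega>) - fmin)\<^sup>2) \<in> borel_measurable M"
      using borel_measurable_integrable[OF f_int[of k]] by simp
    show "AE \<omega> in M. norm ((f (x k \<omega>) - fmin)\<^sup>2) \<le> norm (R\<^sup>2 * (norm (g k \<omega>))\<^sup>2)"
      using gap[of k] by eventually_elim simp
  qed
  \<comment> \<open>Nonnegativity of the variance moves the square inside the expectation, where
    \<open>gap\<close> applies.\<close>
  have a_sq: "(a k)\<^sup>2 \<le> R\<^sup>2 * (\<integral>\<omega>. (norm (g k \<omega>))\<^sup>2 \<partial>M)" for k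
  proof -
    have "(a k)\<^sup>2 \<le> (\<integral>\<omega>. (f (x k \<omega>) - fmin)\<^sup>2 \<partial>M)"
      unfolding a_eq using f_int[of k] gap_int[of k] by (intro expectation_square_le) simp_all
    also have "\<dots> \<le> (\<integral>\<omega>. R\<^sup>2 * (norm (g k \<omega>))\<^sup>2 \<partial>M)"
      using gap_int[of k] g2_int[of k] gap[of k] by (intro integral_mono_AE) simp_all
    finally show ?thesis by simp
  qed
  have step: "a (Suc k) \<le> a k - \<alpha> / (2 * R\<^sup>2) * (a k)\<^sup>2" for k
  proof -
    have "(\<integral>\<omega>. f (x (Suc k) \<omega>) \<partial>M) \<le> (\<integral>\<omega>. f (x k \<omega>) - \<alpha> / 2 * (g k \<omega> \<bullet> (A k \<omega> *v g k \<omega>)) \<partial>M)"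
      using f_int form_int[of k] decrease[of k] by (intro integral_mono_AE) simp_all
    also have "\<dots> = (\<integral>\<omega>. f (x k \<omega>) \<partial>M) - \<alpha> / 2 * (\<integral>\<omega>. (norm (g k \<omega>))\<^sup>2 \<partial>M)"
      using f_int[of k] form_int[of k] by (simp add: form_exp)
    finally have "a (Suc k) \<le> a k - \<alpha> / 2 * (\<integral>\<omega>. (norm (g k \<omega>))\<^sup>2 \<partial>M)"
      by (simp add: a_def)
    moreover have "\<alpha> / (2 * R\<^sup>2) * (a k)\<^sup>2 \<le> \<alpha> / (2 * R\<^sup>2) * (R\<^sup>2 * (\<integral>\<omega>. (norm (g k \<omega>))\<^sup>2 \<partial>M))"
      using a_sq[of k] \<alpha>_pos by (intro mult_left_mono) auto
    ultimately show ?thesis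
      using assms(13) by simp
  qed
  have "a k \<le> 2 * real CARD('d) * lam * R\<^sup>2 / (real k * real CARD('l))" if "k \<ge> 1" for k
  proof -
    \<comment> \<open>The constant combines the factor \<open>\<alpha> / 2\<close> of the expected
      decrease with the factor \<open>1 / R\<^sup>2\<close> from \<open>a_sq\<close>.\<close>
    have "a k \<le> 1 / (\<alpha> / (2 * R\<^sup>2) * real k)"
      using \<alpha>_pos assms(13) that by (intro quadratic_decrease_bound[where a = a] a_nonneg step) simp_all
    also have "\<dots> = 2 * real CARD('d) * lam * R\<^sup>2 / (real k * real CARD('l))"
      by (simp add: assms(15) field_simps)
    finally show ?thesis .
  qed
  then show ?thesis
    using f_int by (simp add: a_def)
qed

end
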